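(* Let $n\geq 1$ and let $A$ be the game subset $[1,n]=\{1,\dots,n\} \subset \mathbb{Z}_{2n+1}$. For the associated group game $\Gamma[A]$, $$d(\Gamma[A],\Gamma[A]^{-1}) \ = \ \beta(\Gamma[A]) \ = \ n^2.$$
   Context: $\mathbb{Z}_{2n+1}$ is the additive group of integers mod $2n+1$, and $\Gamma[A]=\{(i,j)\in\mathbb{Z}_{2n+1}\times\mathbb{Z}_{2n+1} : j-i\in A\}$, which is a regular tournament (a "game"): for distinct $i,j$ exactly one of $(i,j),(j,i)$ lies in it and every vertex has $n$ outputs and $n$ inputs. $\Gamma^{-1}=\{(j,i):(i,j)\in\Gamma\}$. A $k$-cycle ($k\ge3$) is a digraph $\{(i_1,i_2),\dots,(i_{k-1},i_k),(i_k,i_1)\}$ with $i_1,\dots,i_k$ distinct. For a digraph $\Delta$ that is Eulerian (every vertex has as many outputs as inputs), the span $\sigma(\Delta)$ is the maximum cardinality of a set of pairwise edge-disjoint cycles with union $\Delta$, and $\beta(\Delta)=|\Delta|-2\sigma(\Delta)$, where $|\Delta|$ is the number of edges. The distance $d(\Gamma,\Pi)$ between two games on the same vertex set is the minimum number of $3$-cycle reversals needed to get from $\Gamma$ to $\Pi$, where one reversal replaces a game $\Gamma$ by $(\Gamma\setminus C)\cup C^{-1}$ for a $3$-cycle $C\subset\Gamma$. *)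

theory Defs
  imports "HOL-Algebra.Elementary_Groups" "HOL-Library.Extended_Nat"
begin

text \<open>A digraph is its set of edges, of type \<^typ>\<open>'a rel\<close>, so that the inverse digraph is the
  relational converse.\<close>

definition game :: "'a set \<Rightarrow> 'a rel \<Rightarrow> bool" where
  "game V \<Gamma> \<longleftrightarrow> finite V \<and> \<Gamma> \<subseteq> V \<times> V \<and> irrefl \<Gamma> \<and>
     (\<forall>i\<in>V. \<forall>j\<in>V. i \<noteq> j \<longrightarrow> ((i, j) \<in> \<Gamma> \<longleftrightarrow> (j, i) \<notin> \<Gamma>)) \<and>
     (\<exists>n. \<forall>i\<in>V. card (\<Gamma> `` {i}) = n \<and> card (\<Gamma>\<inverse> `` {i}) = n)"

text \<open>In the additive group of integers mod \<open>m\<close> the membership condition reads \<open>j - i \<in> A\<close>.\<close>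

definition group_game :: "('a, 'b) monoid_scheme \<Rightarrow> 'a set \<Rightarrow> 'a rel" where
  "group_game G A = {(i, j) \<in> carrier G \<times> carrier G. inv\<^bsub>G\<^esub> i \<otimes>\<^bsub>G\<^esub> j \<in> A}"

text \<open>\<^term>\<open>zip xs (rotate1 xs)\<close> lists the edges from each vertex to its cyclic successor.\<close>

definition is_kcycle :: "nat \<Rightarrow> 'a rel \<Rightarrow> bool" where
  "is_kcycle k C \<longleftrightarrow> 3 \<le> k \<and>
     (\<exists>xs. length xs = k \<and> distinct xs \<and> C = set (zip xs (rotate1 xs)))"

definition is_cycle :: "'a rel \<Rightarrow> bool" where
  "is_cycle C \<longleftrightarrow> (\<exists>k. is_kcycle k C)"

definition cycle_decomposition :: "'a rel \<Rightarrow> 'a rel set \<Rightarrow> bool" where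
  "cycle_decomposition \<Delta> S \<longleftrightarrow> (\<forall>C\<in>S. is_cycle C) \<and> pairwise disjnt S \<and> \<Union>S = \<Delta>"

text \<open>Meaningful for finite digraphs that have a cycle decomposition at all, in particular for
  games, which are finite and Eulerian.\<close>

definition cycle_span :: "'a rel \<Rightarrow> nat" where
  "cycle_span \<Delta> = Max {card S | S. cycle_decomposition \<Delta> S}"

definition beta :: "'a rel \<Rightarrow> int" where
  "beta \<Delta> = int (card \<Delta>) - 2 * int (cycle_span \<Delta>)"

definition reversal_step :: "'a set \<Rightarrow> 'a rel rel" where
  "reversal_step V = {(\<Gamma>, (\<Gamma> - C) \<union> C\<inverse>) | \<Gamma> C. game V \<Gamma> \<and> is_kcycle 3 C \<and> C \<subseteq> \<Gamma>}"

text \<open>The value is \<^term>\<open>\<infinity> :: enat\<close> if no sequence of reversals leads from \<open>\<Gamma>\<close> to \<open>\<Delta>\<close>.\<close>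

definition game_dist :: "'a set \<Rightarrow> 'a rel \<Rightarrow> 'a rel \<Rightarrow> enat" where
  "game_dist V \<Gamma> \<Delta> = Inf {enat k | k. (\<Gamma>, \<Delta>) \<in> reversal_step V ^^ k}"

end

theory Submission imports Defs begin

text \<open>Order the vertices as \<open>0 < \<dots> < 2 n\<close>, and call an edge a descent if it leads to a smaller
  vertex. Every cycle contains a descent, so the span is at most the number \<open>n (n + 1) / 2\<close> of
  descents; and reversing a 3-cycle creates at most one new descent on balance, while passing to the
  inverse game turns all ascents into descents. An explicit decomposition into 3- and 4-cycles with
  exactly one descent each attains the bound on the span. Since a \<open>k\<close>-cycle can be reversed by
  \<open>k - 2\<close> reversals of 3-cycles, it attains the bound on the distance as well.\<close>

section \<open>Reversal of 3-cycles, of longer cycles and of edge-disjoint families of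
  cycles\<close>

text \<open>\<open>C\<close> may be any digraph, so that a longer cycle or a union of cycles can be
  reversed at once; a \<open>reversal_step\<close> is the case of a 3-cycle contained in a
  game.\<close>

definition reverse_edges :: "'a rel \<Rightarrow> 'a rel \<Rightarrow> 'a rel" where
  "reverse_edges C P = (P - C) \<union> C\<inverse>"

lemma game_asym: "game V P \<Longrightarrow> (x, y) \<in> P \<Longrightarrow> (y, x) \<notin> P"
  unfolding game_def irrefl_def by (metis SigmaD1 SigmaD2 subsetD)

lemma game_finite: "game V P \<Longrightarrow> finite P"
  unfolding game_def by (meson finite_SigmaI finite_subset)

lemma is_3cycle_iff:
  "is_kcycle 3 C \<longleftrightarrow> (\<exists>a b c. distinct [a, b, c] \<and> C = {(a, b), (b, c), (c, a)})"
proof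
  assume "is_kcycle 3 C"
  then obtain xs where xs: "length xs = 3" "distinct xs" "C = set (zip xs (rotate1 xs))"
    unfolding is_kcycle_def by blast
  have "\<exists>a b c. xs = [a, b, c]"
    using xs(1) unfolding numeral_3_eq_3 length_Suc_conv by blast
  then obtain a b c where "xs = [a, b, c]" by blast
  then have "distinct [a, b, c] \<and> C = {(a, b), (b, c), (c, a)}"
    using xs by simp
  then show "\<exists>a b c. distinct [a, b, c] \<and> C = {(a, b), (b, c), (c, a)}" by blast
next
  assume "\<exists>a b c. distinct [a, b, c] \<and> C = {(a, b), (b, c), (c, a)}"
  then obtain a b c where "distinct [a, b, c]" "C = {(a, b), (b, c), (c, a)}"
    by blast
  then show "is_kcycle 3 C"
    unfolding is_kcycle_def by (intro conjI exI[of _ "[a, b, c]"]) auto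
qed

lemma card_kcycle: "is_kcycle k C \<Longrightarrow> card C = k"
  unfolding is_kcycle_def by (auto simp: distinct_zipI1 distinct_card)

text \<open>As an output, each vertex of the 3-cycle trades its successor for its predecessor.
  Finiteness and asymmetry, in place of \<open>game\<close>, are passed on directly to the converse
  digraph, where the lemma counts inputs.\<close>

lemma card_outputs_reverse_3cycle:
  assumes "finite P" and asym: "\<And>x y. (x, y) \<in> P \<Longrightarrow> (y, x) \<notin> P"
    and C: "is_kcycle 3 C" "C \<subseteq> P"
  shows "card (reverse_edges C P `` {i}) = card (P `` {i})"
proof -
  have fin: "finite (P `` {i})" for i
    using \<open>finite P\<close> by (rule finite_Image)
  have eq: "card (reverse_edges C P `` {a}) = card (P `` {a})"
    if "distinct [a, b, c]" "C = {(a, b), (b, c), (c, a)}" for a b c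
  proof -
    have "reverse_edges C P `` {a} = insert c (P `` {a} - {b})"
      using that by (auto simp: reverse_edges_def)
    moreover have "b \<in> P `` {a}" "c \<notin> P `` {a}"
      using that C(2) asym by auto
    ultimately show ?thesis
      using fin[of a] card.remove[of "P `` {a}" b] by simp
  qed
  obtain a b c where abc: "distinct [a, b, c]" "C = {(a, b), (b, c), (c, a)}"
    using C(1) by (auto simp only: is_3cycle_iff)
  consider "i = a" | "i = b" | "i = c" | "i \<notin> {a, b, c}" by blast
  then show ?thesis
  proof cases
    case 1 then show ?thesis using eq abc by blast
  next
    case 2
    moreover have "C = {(b, c), (c, a), (a, b)}" using abc by blast
    ultimately show ?thesis using eq[of b c a] abc by auto
  next
    case 3
    moreover have "C = {(c, a), (a, b), (b, c)}" using abc by blast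
    ultimately show ?thesis using eq[of c a b] abc by auto
  next
    case 4
    then have "reverse_edges C P `` {i} = P `` {i}"
      using abc by (auto simp: reverse_edges_def)
    then show ?thesis by simp
  qed
qed

lemma game_reverse_3cycle:
  assumes P: "game V P" and C: "is_kcycle 3 C" "C \<subseteq> P"
  shows "game V (reverse_edges C P)"
proof -
  have fin: "finite P" using P by (rule game_finite)
  have asym: "(x, y) \<in> P \<Longrightarrow> (y, x) \<notin> P" for x y using P by (rule game_asym)
  have conv: "is_kcycle 3 (C\<inverse>)" "C\<inverse> \<subseteq> P\<inverse>"
  proof -
    obtain a b c where "distinct [a, b, c]" "C = {(a, b), (b, c), (c, a)}"
      using C(1) by (auto simp only: is_3cycle_iff)
    then have "distinct [c, b, a]" "C\<inverse> = {(c, b), (b, a), (a, c)}" by auto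
    then show "is_kcycle 3 (C\<inverse>)" unfolding is_3cycle_iff by blast
  qed (use C in auto)
  \<comment> \<open>Inputs are outputs of the converse, and reversal commutes with taking
    converses.\<close>
  have "(reverse_edges C P)\<inverse> = reverse_edges (C\<inverse>) (P\<inverse>)"
    by (auto simp: reverse_edges_def)
  moreover have "card (reverse_edges (C\<inverse>) (P\<inverse>) `` {i}) = card (P\<inverse> `` {i})" for i
    by (rule card_outputs_reverse_3cycle[OF _ _ conv]) (use fin asym in \<open>blast+\<close>)
  ultimately have "\<exists>n. \<forall>i\<in>V. card (reverse_edges C P `` {i}) = n
      \<and> card ((reverse_edges C P)\<inverse> `` {i}) = n"
    using P card_outputs_reverse_3cycle[OF fin asym C] unfolding game_def by metis
  moreover have "\<forall>i\<in>V. \<forall>j\<in>V. i \<noteq> j \<longrightarrow>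
      ((i, j) \<in> reverse_edges C P \<longleftrightarrow> (j, i) \<notin> reverse_edges C P)"
    using P C(2) asym unfolding game_def reverse_edges_def by blast
  moreover have "finite V" "reverse_edges C P \<subseteq> V \<times> V" "irrefl (reverse_edges C P)"
    using P C(2) unfolding game_def reverse_edges_def irrefl_def by blast+
  ultimately show ?thesis unfolding game_def by blast
qed

lemma reversal_stepI:
  "game V P \<Longrightarrow> is_kcycle 3 C \<Longrightarrow> C \<subseteq> P \<Longrightarrow> (P, reverse_edges C P) \<in> reversal_step V"
  unfolding reversal_step_def reverse_edges_def by blast

lemma reversal_stepE:
  assumes "(P, Q) \<in> reversal_step V"
  obtains C where "game V P" "is_kcycle 3 C" "C \<subseteq> P" "Q = reverse_edges C P"
  using assms unfolding reversal_step_def reverse_edges_def by blast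

lemma game_reversal_steps:
  "(P, Q) \<in> reversal_step V ^^ k \<Longrightarrow> game V P \<Longrightarrow> game V Q"
proof (induction k arbitrary: Q)
  case (Suc k)
  then obtain R where "game V R" "(R, Q) \<in> reversal_step V" by auto
  then show ?case by (metis reversal_stepE game_reverse_3cycle)
qed simp

text \<open>The chord joining two vertices at distance two splits the cycle into a 3-cycle and a cycle
  shorter by one edge. Whichever of the two the chord currently belongs to is reversed first; the
  second reversal then restores the chord.\<close>

lemma reverse_cycle_list:
  assumes "game V P" "distinct (a # b # c # ys)"
    and "set (zip (a # b # c # ys) (b # c # ys @ [a])) \<subseteq> P"
  shows "(P, reverse_edges (set (zip (a # b # c # ys) (b # c # ys @ [a]))) P)
    \<in> reversal_step V ^^ Suc (length ys)"
  using assms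
\<comment> \<open>The vertex \<open>a\<close> stays fixed while \<open>b\<close> and
  \<open>c\<close> move along the cycle. \<open>P\<close> is general because the shorter cycle may
  be reversed after the 3-cycle, in a game that has already changed.\<close>
proof (induction ys arbitrary: b c P)
  case Nil
  then have "is_kcycle 3 {(a, b), (b, c), (c, a)}"
    unfolding is_3cycle_iff by (intro exI[of _ a] exI[of _ b] exI[of _ c]) simp
  with Nil show ?case by (simp add: reversal_stepI)
next
  case (Cons d ys)
  \<comment> \<open>\<open>E\<close> is the path from \<open>d\<close> back to \<open>a\<close>,
    \<open>C\<close> the whole cycle, \<open>Q\<close> the cycle shortened by the chord
    \<open>(a, c)\<close>, and \<open>T\<close> the 3-cycle closed by the opposite chord
    \<open>(c, a)\<close>.\<close>
  define E where "E = set (zip (d # ys) (ys @ [a]))"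
  define C where "C = {(a, b), (b, c), (c, d)} \<union> E"
  define Q where "Q = {(a, c), (c, d)} \<union> E"
  define T where "T = {(a, b), (b, c), (c, a)}"
  have C: "set (zip (a # b # c # d # ys) (b # c # (d # ys) @ [a])) = C"
    and Q: "set (zip (a # c # d # ys) (c # d # ys @ [a])) = Q"
    by (auto simp: C_def Q_def E_def)
  have CP: "C \<subseteq> P" using Cons.prems(3) unfolding C .
  \<comment> \<open>Distinctness keeps \<open>E\<close> clear of the edges of \<open>T\<close> in
    either direction, so reversing \<open>T\<close> does not touch this path.\<close>
  have E: "x \<notin> {a, b, c} \<and> y \<notin> {b, c, d}" if "(x, y) \<in> E" for x y
    using that Cons.prems(2) unfolding E_def by (auto elim!: in_set_zipE)
  have dist: "distinct [a, b, c, d]" using Cons.prems(2) by auto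
  have IH: "(P', reverse_edges Q P') \<in> reversal_step V ^^ Suc (length ys)"
    if "game V P'" "Q \<subseteq> P'" for P'
    using Cons.IH[of P' c d] that Cons.prems(2) unfolding Q by auto
  have T: "is_kcycle 3 T"
    unfolding is_3cycle_iff T_def using dist by (intro exI[of _ a] exI[of _ b] exI[of _ c]) simp
  have asym: "\<And>x y. (x, y) \<in> P \<Longrightarrow> (y, x) \<notin> P"
    using Cons.prems(1) by (rule game_asym)
  have "a \<in> V" "c \<in> V" using CP Cons.prems(1) unfolding C_def game_def by auto
  then consider (backward) "(c, a) \<in> P" "(a, c) \<notin> P" | (forward) "(a, c) \<in> P" "(c, a) \<notin> P"
    using Cons.prems(1) dist unfolding game_def by fastforce
  then have "(P, reverse_edges C P) \<in> reversal_step V ^^ Suc (Suc (length ys))"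
  proof cases
    case backward
    have TP: "T \<subseteq> P" using CP backward unfolding T_def C_def by auto
    let ?P = "reverse_edges T P"
    have "Q \<subseteq> ?P"
      using CP E dist unfolding Q_def T_def C_def reverse_edges_def by auto
    then have "(?P, reverse_edges Q ?P) \<in> reversal_step V ^^ Suc (length ys)"
      using IH game_reverse_3cycle[OF Cons.prems(1) T TP] by blast
    moreover have "reverse_edges Q ?P = reverse_edges C P"
      using CP E dist backward asym unfolding Q_def T_def C_def reverse_edges_def by auto
    ultimately show ?thesis
      using reversal_stepI[OF Cons.prems(1) T TP] by (metis relpow_Suc_I2)
  next
    case forward
    have QP: "Q \<subseteq> P" using CP forward unfolding Q_def C_def by auto
    let ?P = "reverse_edges Q P"
    have step: "(P, ?P) \<in> reversal_step V ^^ Suc (length ys)"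
      using IH Cons.prems(1) QP by blast
    then have "game V ?P" using Cons.prems(1) by (rule game_reversal_steps)
    moreover have "T \<subseteq> ?P"
      using CP E dist unfolding Q_def T_def C_def reverse_edges_def by auto
    ultimately have "(?P, reverse_edges T ?P) \<in> reversal_step V"
      using T by (intro reversal_stepI)
    moreover have "reverse_edges T ?P = reverse_edges C P"
      using CP E dist forward asym unfolding Q_def T_def C_def reverse_edges_def by auto
    ultimately show ?thesis using step by (metis relpow_Suc_I)
  qed
  then show ?case unfolding C by simp
qed

lemma reverse_cycle:
  assumes "game V P" "is_cycle C" "C \<subseteq> P"
  shows "(P, reverse_edges C P) \<in> reversal_step V ^^ (card C - 2)"
proof -
  obtain k where k: "is_kcycle k C" using assms(2) unfolding is_cycle_def by blast
  then obtain xs where xs: "3 \<le> k" "length xs = k" "distinct xs" "C = set (zip xs (rotate1 xs))"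
    unfolding is_kcycle_def by blast
  obtain a b c ys where abc: "xs = a # b # c # ys"
  proof (cases xs)
    case (Cons a zs)
    then show thesis using xs(1,2) that
      by (cases zs; cases "tl zs") simp_all
  qed (use xs(1,2) in simp)
  have C: "C = set (zip (a # b # c # ys) (b # c # ys @ [a]))"
    using xs(4) unfolding abc by simp
  \<comment> \<open>The cycle has \<open>length ys + 3\<close> edges.\<close>
  have len: "card C - 2 = Suc (length ys)"
    using card_kcycle[OF k] xs(2) unfolding abc by simp
  show ?thesis
    unfolding len unfolding C
    using assms(1) xs(3)[unfolded abc] assms(3)[unfolded C] by (rule reverse_cycle_list)
qed

lemma cycle_card_ge: "is_cycle C \<Longrightarrow> 3 \<le> card C"
  unfolding is_cycle_def by (metis card_kcycle is_kcycle_def)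

text \<open>Edge-disjoint cycles do not disturb each other, so they can be reversed in turn, at a
  cost of \<open>card C - 2\<close> each. The inequality is carried along to make the truncated
  subtraction additive.\<close>

lemma reverse_cycle_decomposition:
  assumes P: "game V P" and "finite S" "\<forall>C\<in>S. is_cycle C" "pairwise disjnt S" "\<Union>S \<subseteq> P"
  shows "2 * card S \<le> card (\<Union>S) \<and>
    (P, reverse_edges (\<Union>S) P) \<in> reversal_step V ^^ (card (\<Union>S) - 2 * card S)"
  using assms(2-)
proof (induction S rule: finite_induct)
  case empty
  then show ?case by (simp add: reverse_edges_def)
next
  case (insert C S)
  let ?Q = "reverse_edges (\<Union>S) P"
  have IH: "2 * card S \<le> card (\<Union>S)" "(P, ?Q) \<in> reversal_step V ^^ (card (\<Union>S) - 2 * card S)"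
    using insert by (auto simp: pairwise_insert)
  have disj: "C \<inter> \<Union>S = {}"
    using insert.prems(2) insert.hyps(2) unfolding pairwise_insert disjnt_def by blast
  have asym: "\<And>x y. (x, y) \<in> P \<Longrightarrow> (y, x) \<notin> P" using P by (rule game_asym)
  have "C \<subseteq> ?Q" using insert.prems(3) disj unfolding reverse_edges_def by auto
  moreover have "game V ?Q" using IH(2) P by (rule game_reversal_steps)
  ultimately have "(?Q, reverse_edges C ?Q) \<in> reversal_step V ^^ (card C - 2)"
    using insert.prems(1) by (intro reverse_cycle) auto
  moreover have "reverse_edges C ?Q = reverse_edges (\<Union>(insert C S)) P"
  proof -
    \<comment> \<open>The edges created by the earlier reversals are not edges of \<open>C\<close>,
      so reversing \<open>C\<close> next does not undo them.\<close>
    have "C \<inter> (\<Union>S)\<inverse> = {}" using insert.prems(3) asym by blast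
    moreover have "\<Union>(insert C S) = C \<union> \<Union>S" by simp
    ultimately show ?thesis
      unfolding reverse_edges_def converse_Un by blast
  qed
  ultimately have steps: "(P, reverse_edges (\<Union>(insert C S)) P)
      \<in> reversal_step V ^^ ((card (\<Union>S) - 2 * card S) + (card C - 2))"
    unfolding relpow_add using IH(2) by (metis relcompI)
  have "finite (\<Union>(insert C S))"
    using insert.prems(3) game_finite[OF P] by (rule finite_subset)
  then have "card (\<Union>(insert C S)) = card C + card (\<Union>S)"
    using disj by (simp add: card_Un_disjoint)
  moreover have "3 \<le> card C" using insert.prems(1) by (simp add: cycle_card_ge)
  ultimately have "card (\<Union>(insert C S)) - 2 * card (insert C S)
      = (card (\<Union>S) - 2 * card S) + (card C - 2)"
    "2 * card (insert C S) \<le> card (\<Union>(insert C S))"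
    using IH(1) insert.hyps by auto
  then show ?case using steps by metis
qed

section \<open>Descents as a bound for the span and for the distance\<close>

definition descents :: "'a::linorder rel \<Rightarrow> 'a rel" where
  "descents P = {(x, y) \<in> P. y < x}"

text \<open>The edge that leaves the largest vertex of the cycle must go down, since it is not a
  loop.\<close>

lemma cycle_descent:
  assumes "is_cycle C" "irrefl C"
  shows "\<exists>e\<in>C. e \<in> descents C"
proof -
  obtain xs where xs: "3 \<le> length xs" "C = set (zip xs (rotate1 xs))"
    using assms(1) unfolding is_cycle_def is_kcycle_def by blast
  then have ne: "set xs \<noteq> {}" by auto
  let ?x = "Max (set xs)"
  have "?x \<in> set xs" using ne by simp
  then obtain i where i: "i < length xs" "xs ! i = ?x" by (metis in_set_conv_nth)
  let ?y = "rotate1 xs ! i"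
  have "(?x, ?y) \<in> C" using i unfolding xs(2) set_zip by (auto intro!: exI[of _ i])
  moreover have "?y \<le> ?x" using i by (metis List.finite_set Max_ge length_rotate1 nth_mem set_rotate1)
  ultimately show ?thesis using assms(2) unfolding descents_def irrefl_def
    by (intro bexI[of _ "(?x, ?y)"]) (auto simp: order.strict_iff_order)
qed

text \<open>Choosing one descent in each cycle is injective because the cycles are
  edge-disjoint.\<close>

lemma card_cycle_decomposition_le:
  assumes "cycle_decomposition \<Delta> S" "finite \<Delta>" "irrefl \<Delta>"
  shows "card S \<le> card (descents \<Delta>)"
proof -
  have S: "\<And>C. C \<in> S \<Longrightarrow> is_cycle C" "pairwise disjnt S" "\<Union>S = \<Delta>"
    using assms(1) unfolding cycle_decomposition_def by auto
  have "\<exists>e. e \<in> C \<and> e \<in> descents \<Delta>" if "C \<in> S" for C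
  proof -
    have "C \<subseteq> \<Delta>" using S(3) that by blast
    moreover from this have "irrefl C" using assms(3) unfolding irrefl_def by blast
    ultimately show ?thesis
      using cycle_descent[OF S(1)[OF that]] unfolding descents_def by auto
  qed
  then obtain f where f: "\<And>C. C \<in> S \<Longrightarrow> f C \<in> C \<and> f C \<in> descents \<Delta>" by metis
  then have "inj_on f S"
    using S(2) unfolding inj_on_def pairwise_def disjnt_iff by metis
  moreover have "f ` S \<subseteq> descents \<Delta>" using f by auto
  moreover have "finite (descents \<Delta>)"
    using assms(2) by (rule rev_finite_subset) (auto simp: descents_def)
  ultimately show ?thesis by (metis card_inj_on_le)
qed

text \<open>The 3-cycle contains a descent \<open>e\<close>, which is lost, and only its other two
  edges can turn into descents.\<close>

lemma card_descents_reversal_step: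
  assumes "(P, Q) \<in> reversal_step V"
  shows "card (descents Q) \<le> card (descents P) + 1"
proof -
  obtain C where C: "game V P" "is_kcycle 3 C" "C \<subseteq> P" "Q = reverse_edges C P"
    using assms by (rule reversal_stepE)
  have "is_cycle C" "irrefl C"
    using C unfolding is_cycle_def game_def irrefl_def by blast+
  then obtain e where e: "e \<in> C" "e \<in> descents C" using cycle_descent by blast
  have fin: "finite C" "finite (descents P)"
    using game_finite[OF C(1)] C(3) by (auto simp: descents_def elim!: rev_finite_subset)
  have eP: "e \<in> descents P" using e C(3) unfolding descents_def by auto
  have "descents Q \<subseteq> (descents P - {e}) \<union> (C - {e})\<inverse>"
    using e unfolding C(4) descents_def reverse_edges_def by auto
  then have "card (descents Q) \<le> card ((descents P - {e}) \<union> (C - {e})\<inverse>)"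
    using fin by (intro card_mono) auto
  also have "\<dots> \<le> card (descents P - {e}) + card ((C - {e})\<inverse>)" by (rule card_Un_le)
  also have "\<dots> = (card (descents P) - 1) + 2"
    using fin eP e(1) card_kcycle[OF C(2)] by simp
  \<comment> \<open>The subtraction is not truncated, because \<open>e\<close> is among the descents
    of \<open>P\<close>.\<close>
  also have "\<dots> = card (descents P) + 1"
    using fin eP card_gt_0_iff[of "descents P"] by auto
  finally show ?thesis .
qed

lemma card_descents_reversal_steps:
  "(P, Q) \<in> reversal_step V ^^ k \<Longrightarrow> card (descents Q) \<le> card (descents P) + k"
proof (induction k arbitrary: Q)
  case (Suc k)
  then obtain R where "(P, R) \<in> reversal_step V ^^ k" "(R, Q) \<in> reversal_step V" by auto
  then show ?case using Suc.IH card_descents_reversal_step by fastforce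
qed simp

lemma card_descents_converse:
  assumes "finite P" "irrefl P"
  shows "card (descents (P\<inverse>)) + card (descents P) = card P"
proof -
  have "descents (P\<inverse>) = (P - descents P)\<inverse>"
    using assms(2) unfolding descents_def irrefl_def by (auto simp: not_less order.strict_iff_order)
  moreover have "descents P \<subseteq> P" unfolding descents_def by auto
  ultimately show ?thesis
    using assms(1) by (simp add: card_Diff_subset finite_subset card_mono)
qed

text \<open>One decomposition settles both values: it attains the upper bound for the span, and
  reversing its cycles in turn leads to the inverse game in as many steps as the descent count
  forces.\<close>

lemma optimal_cycle_decomposition:
  fixes P :: "'a::linorder rel"
  assumes P: "game V P" and S: "cycle_decomposition P S" and card: "card S = card (descents P)"
  shows "beta P = int (card P) - 2 * int (card (descents P))"
    and "game_dist V P (P\<inverse>) = enat (nat (beta P))"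
proof -
  have fin: "finite P" and irr: "irrefl P"
    using P game_finite unfolding game_def by blast+
  have le: "\<And>S. cycle_decomposition P S \<Longrightarrow> card S \<le> card (descents P)"
    using card_cycle_decomposition_le fin irr by blast
  have "cycle_span P = card (descents P)"
    unfolding cycle_span_def
  proof (rule Max_eqI)
    show "finite {card S |S. cycle_decomposition P S}"
      by (rule finite_subset[of _ "{..card (descents P)}"]) (use le in auto)
    show "card (descents P) \<in> {card S |S. cycle_decomposition P S}"
      using S card by (metis (mono_tags, lifting) mem_Collect_eq)
  qed (use le in auto)
  then show beta: "beta P = int (card P) - 2 * int (card (descents P))"
    by (simp add: beta_def)
  have S': "\<forall>C\<in>S. is_cycle C" "pairwise disjnt S" "\<Union>S = P"
    using S unfolding cycle_decomposition_def by auto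
  then have "finite S" using fin by (metis finite_UnionD)
  then have "(P, reverse_edges P P) \<in> reversal_step V ^^ (card P - 2 * card S)"
    using reverse_cycle_decomposition[OF P, of S] S' by simp
  moreover have "reverse_edges P P = P\<inverse>" by (simp add: reverse_edges_def)
  ultimately have reach: "(P, P\<inverse>) \<in> reversal_step V ^^ (card P - 2 * card (descents P))"
    by (simp add: card)
  \<comment> \<open>With \<open>d\<close> descents in \<open>P\<close>, the count has to rise from
    \<open>d\<close> to \<open>card P - d\<close>, by at most one per step.\<close>
  have lower: "card P - 2 * card (descents P) \<le> k" if "(P, P\<inverse>) \<in> reversal_step V ^^ k" for k
    using card_descents_reversal_steps[OF that] card_descents_converse[OF fin irr] by linarith
  have "game_dist V P (P\<inverse>) = enat (card P - 2 * card (descents P))"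
    unfolding game_dist_def
  proof (rule antisym)
    show "Inf {enat k |k. (P, P\<inverse>) \<in> reversal_step V ^^ k}
        \<le> enat (card P - 2 * card (descents P))"
      using reach by (intro Inf_lower) blast
    show "enat (card P - 2 * card (descents P))
        \<le> Inf {enat k |k. (P, P\<inverse>) \<in> reversal_step V ^^ k}"
      using lower by (intro Inf_greatest) auto
  qed
  then show "game_dist V P (P\<inverse>) = enat (nat (beta P))"
    unfolding beta by (simp add: nat_diff_distrib')
qed


section \<open>The game on the representatives 0 to 2n\<close>

text \<open>The group game with the reduction mod \<open>2 * n + 1\<close> resolved, so that the
  order of the integers is available: ascents have length at most \<open>n\<close>, descents length
  greater than \<open>n\<close>.\<close>

definition half_game :: "nat \<Rightarrow> int rel" where
  "half_game n = {(i, j) \<in> {0..2 * int n} \<times> {0..2 * int n}. i < j \<and> j - i \<le> int n \<or> int n < i - j}"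

lemma group_game_half:
  "group_game (integer_mod_group (2 * n + 1)) {1..int n} = half_game n"
proof -
  have key: "(- i mod (1 + 2 * int n) + j) mod (1 + 2 * int n) \<in> {1..int n}
      \<longleftrightarrow> i < j \<and> j - i \<le> int n \<or> int n < i - j"
    if "0 \<le> i" "i \<le> 2 * int n" "0 \<le> j" "j \<le> 2 * int n" for i j
  proof -
    have "(- i mod (1 + 2 * int n) + j) mod (1 + 2 * int n) = (j - i) mod (1 + 2 * int n)"
      by (simp add: mod_add_left_eq)
    \<comment> \<open>Since \<open>j - i\<close> lies between \<open>- 2 * n\<close> and
      \<open>2 * n\<close>, adding the modulus at most once gives the residue. If it is added, the
      residue is at most \<open>n\<close> exactly when \<open>i - j > n\<close>.\<close>
    also have "\<dots> = (if i \<le> j then j - i else j - i + (1 + 2 * int n))"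
    proof (cases "i \<le> j")
      case False
      have "(j - i) mod (1 + 2 * int n) = (j - i + (1 + 2 * int n)) mod (1 + 2 * int n)"
        by (rule mod_add_self2[symmetric])
      also have "\<dots> = j - i + (1 + 2 * int n)"
        using False that by (intro mod_pos_pos_trivial) auto
      finally show ?thesis using False by simp
    qed (use that in \<open>simp add: mod_pos_pos_trivial\<close>)
    finally show ?thesis using that by auto
  qed
  have "(i, j) \<in> group_game (integer_mod_group (2 * n + 1)) {1..int n} \<longleftrightarrow> (i, j) \<in> half_game n"
    for i j
    using key[of i j]
    by (cases "i \<in> {0..2 * int n} \<and> j \<in> {0..2 * int n}")
      (auto simp: group_game_def half_game_def carrier_integer_mod_group)
  then show ?thesis by auto
qed

text \<open>For \<open>i < n\<close> all outputs are ascents; otherwise \<open>2 * n - i\<close>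
  ascents and \<open>i - n\<close> descents leave \<open>i\<close>.\<close>

lemma card_outputs_half_game:
  assumes "i \<in> {0..2 * int n}"
  shows "card (half_game n `` {i}) = n"
proof (cases "i < int n")
  case True
  then have "half_game n `` {i} = {i + 1..i + int n}"
    using assms unfolding half_game_def by auto
  then show ?thesis by simp
next
  case False
  then have "half_game n `` {i} = {i + 1..2 * int n} \<union> {0..<i - int n}"
    using assms unfolding half_game_def by auto
  moreover have "card ({i + 1..2 * int n} \<union> {0..<i - int n})
      = card {i + 1..2 * int n} + card {0..<i - int n}"
    using False by (intro card_Un_disjoint) auto
  ultimately show ?thesis using assms False by simp
qed

lemma card_inputs_half_game:
  assumes "i \<in> {0..2 * int n}"
  shows "card ((half_game n)\<inverse> `` {i}) = n"
proof (cases "i < int n")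
  case True
  then have "(half_game n)\<inverse> `` {i} = {0..<i} \<union> {i + int n + 1..2 * int n}"
    using assms unfolding half_game_def by auto
  moreover have "card ({0..<i} \<union> {i + int n + 1..2 * int n})
      = card {0..<i} + card {i + int n + 1..2 * int n}"
    using True by (intro card_Un_disjoint) auto
  ultimately show ?thesis using assms True by simp
next
  case False
  then have "(half_game n)\<inverse> `` {i} = {i - int n..<i}"
    using assms unfolding half_game_def by auto
  then show ?thesis by simp
qed

lemma game_half_game: "game {0..2 * int n} (half_game n)"
proof -
  have "half_game n \<subseteq> {0..2 * int n} \<times> {0..2 * int n}" "irrefl (half_game n)"
    "\<forall>i\<in>{0..2 * int n}. \<forall>j\<in>{0..2 * int n}.
       i \<noteq> j \<longrightarrow> ((i, j) \<in> half_game n \<longleftrightarrow> (j, i) \<notin> half_game n)"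
    by (auto simp: half_game_def irrefl_def)
  then show ?thesis
    using card_outputs_half_game card_inputs_half_game unfolding game_def by blast
qed

lemma card_half_game: "card (half_game n) = (2 * n + 1) * n"
proof -
  have "half_game n = (SIGMA i:{0..2 * int n}. half_game n `` {i})"
    by (auto simp: half_game_def)
  then have "card (half_game n) = (\<Sum>i\<in>{0..2 * int n}. card (half_game n `` {i}))"
    using game_finite[OF game_half_game, of n]
    by (metis card_SigmaI finite_Image finite_atLeastAtMost_int)
  also have "\<dots> = (\<Sum>i\<in>{0..2 * int n}. n)"
    by (intro sum.cong refl card_outputs_half_game)
  also have "\<dots> = (2 * n + 1) * n" by (simp add: nat_add_distrib nat_mult_distrib)
  finally show ?thesis .
qed

section \<open>Counting descents and decomposing into 3- and 4-cycles\<close>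

text \<open>A common index set for the descents and for the cycles of the decomposition. In the
  latter, \<open>k\<close> is the stage and \<open>l = n\<close> marks its 3-cycle.\<close>

definition index_pairs :: "nat \<Rightarrow> int rel" where
  "index_pairs n = {(k, l). 0 \<le> k \<and> k < l \<and> l \<le> int n}"

text \<open>Each \<open>l\<close> has \<open>l\<close> partners \<open>k\<close>, which gives a
  triangular number; doubling avoids a division.\<close>

lemma card_index_pairs: "2 * card (index_pairs n) = n * (n + 1)"
proof -
  let ?f = "\<lambda>(l, k). (int k, int l)"
  have "(k, l) \<in> ?f ` (SIGMA l:{..n}. {..<l})" if "(k, l) \<in> index_pairs n" for k l
    using that by (intro image_eqI[of _ _ "(nat l, nat k)"]) (auto simp: index_pairs_def)
  moreover have "?f ` (SIGMA l:{..n}. {..<l}) \<subseteq> index_pairs n"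
    by (auto simp: index_pairs_def)
  ultimately have "index_pairs n = ?f ` (SIGMA l:{..n}. {..<l})" by auto
  moreover have "inj_on ?f (SIGMA l:{..n}. {..<l})" by (auto intro!: inj_onI)
  ultimately have "card (index_pairs n) = card (SIGMA l:{..n}. {..<l})"
    by (simp add: card_image)
  also have "\<dots> = (\<Sum>l\<le>n. l)" by simp
  finally show ?thesis using gauss_sum_nat[of n] by (simp add: atMost_atLeast0)
qed

text \<open>Write the tail of a descent with head \<open>k\<close> as \<open>n + l\<close>; its
  length exceeds \<open>n\<close> exactly when \<open>k < l\<close>.\<close>

lemma card_descents_half_game: "card (descents (half_game n)) = card (index_pairs n)"
proof -
  let ?f = "\<lambda>(k, l). (int n + l, k)"
  have "(i, j) \<in> ?f ` index_pairs n" if "(i, j) \<in> descents (half_game n)" for i j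
    using that by (intro image_eqI[of _ _ "(j, i - int n)"])
      (auto simp: descents_def half_game_def index_pairs_def)
  moreover have "?f ` index_pairs n \<subseteq> descents (half_game n)"
    by (auto simp: descents_def half_game_def index_pairs_def)
  ultimately have "descents (half_game n) = ?f ` index_pairs n" by auto
  then show ?thesis by (simp add: card_image inj_on_def split: prod.splits)
qed

text \<open>Deleting the vertices \<open>0\<close> and \<open>n\<close> from the game on \<open>2 n + 1\<close> vertices and closing the gaps
  leaves the same game on \<open>2 n - 1\<close> vertices. The deleted edges split into the \<open>4\<close>-cycles through
  \<open>0, l, n, n + l\<close> for \<open>0 < l < n\<close> and the \<open>3\<close>-cycle through \<open>0, n, 2 n\<close>; at the \<open>k\<close>-th stage the
  deleted vertices are \<open>k\<close> and \<open>n + k\<close>.\<close>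

definition pair_cycle :: "nat \<Rightarrow> int \<times> int \<Rightarrow> int rel" where
  "pair_cycle n = (\<lambda>(k, l).
     if l < int n then {(k, l), (l, int n + k), (int n + k, int n + l), (int n + l, k)}
     else {(k, int n + k), (int n + k, 2 * int n), (2 * int n, k)})"

text \<open>This recovers from an edge the index of the cycle through it. With an explicit formula,
  disjointness and injectivity (by \<open>edge_pair_eq\<close>) and covering (by
  \<open>edge_pair_mem\<close>) become case checks.\<close>

definition edge_pair :: "nat \<Rightarrow> int \<times> int \<Rightarrow> int \<times> int" where
  "edge_pair n = (\<lambda>(i, j).
     if i < int n then
       if j < int n then (i, j) else if j = int n + i then (i, int n) else (j - int n, i)
     else if j < int n then (j, i - int n) else (i - int n, j - int n))"

lemma is_cycle_pair_cycle:
  assumes "p \<in> index_pairs n"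
  shows "is_cycle (pair_cycle n p)"
proof -
  obtain k l where p: "p = (k, l)" "0 \<le> k" "k < l" "l \<le> int n"
    using assms by (auto simp: index_pairs_def)
  show ?thesis
  proof (cases "l < int n")
    case True
    then have "is_kcycle 4 (pair_cycle n p)"
      unfolding is_kcycle_def
      using p by (intro conjI exI[of _ "[k, l, int n + k, int n + l]"])
        (auto simp: pair_cycle_def)
    then show ?thesis unfolding is_cycle_def by blast
  next
    case False
    then have "is_kcycle 3 (pair_cycle n p)"
      unfolding is_kcycle_def
      using p by (intro conjI exI[of _ "[k, int n + k, 2 * int n]"])
        (auto simp: pair_cycle_def)
    then show ?thesis unfolding is_cycle_def by blast
  qed
qed

lemma edge_pair_eq:
  "p \<in> index_pairs n \<Longrightarrow> e \<in> pair_cycle n p \<Longrightarrow> edge_pair n e = p"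
  by (auto simp: index_pairs_def pair_cycle_def edge_pair_def split: if_splits)

lemma pair_cycle_subset: "p \<in> index_pairs n \<Longrightarrow> pair_cycle n p \<subseteq> half_game n"
  by (auto simp: index_pairs_def pair_cycle_def half_game_def split: if_splits)

lemma edge_pair_mem:
  "e \<in> half_game n \<Longrightarrow> edge_pair n e \<in> index_pairs n \<and> e \<in> pair_cycle n (edge_pair n e)"
  by (auto simp: index_pairs_def pair_cycle_def edge_pair_def half_game_def split: if_splits)

lemma half_game_decomposition:
  "cycle_decomposition (half_game n) (pair_cycle n ` index_pairs n)"
  "card (pair_cycle n ` index_pairs n) = card (index_pairs n)"
proof -
  have "pairwise disjnt (pair_cycle n ` index_pairs n)"
    unfolding pairwise_def disjnt_iff by (metis edge_pair_eq imageE)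
  moreover have "\<Union>(pair_cycle n ` index_pairs n) = half_game n"
    using pair_cycle_subset edge_pair_mem by blast
  ultimately show "cycle_decomposition (half_game n) (pair_cycle n ` index_pairs n)"
    unfolding cycle_decomposition_def using is_cycle_pair_cycle by blast
  have "inj_on (pair_cycle n) (index_pairs n)"
  proof (rule inj_onI)
    fix p q assume pq: "p \<in> index_pairs n" "q \<in> index_pairs n" "pair_cycle n p = pair_cycle n q"
    \<comment> \<open>Any single edge of a cycle determines its index.\<close>
    have "pair_cycle n p \<noteq> {}" by (auto simp: pair_cycle_def split: prod.splits)
    then obtain e where "e \<in> pair_cycle n p" by blast
    then show "p = q" using edge_pair_eq pq by metis
  qed
  then show "card (pair_cycle n ` index_pairs n) = card (index_pairs n)" by (rule card_image)
qed

theorem theorem5p7: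
  fixes n :: nat
  assumes "n \<ge> 1"
  defines "Z \<equiv> integer_mod_group (2 * n + 1)"
  defines "\<Gamma> \<equiv> group_game Z {1..int n}"
  shows "game_dist (carrier Z) \<Gamma> (\<Gamma>\<inverse>) = enat (nat (beta \<Gamma>)) \<and> beta \<Gamma> = int (n\<^sup>2)"
proof -
  have \<Gamma>: "\<Gamma> = half_game n" unfolding \<Gamma>_def Z_def by (rule group_game_half)
  have Z: "carrier Z = {0..2 * int n}" unfolding Z_def by (auto simp: carrier_integer_mod_group)
  have opt: "beta \<Gamma> = int (card \<Gamma>) - 2 * int (card (descents \<Gamma>))"
    "game_dist (carrier Z) \<Gamma> (\<Gamma>\<inverse>) = enat (nat (beta \<Gamma>))"
    unfolding \<Gamma> Z
    \<comment> \<open>Cycles and descents are equally many, both being indexed by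
      \<open>index_pairs n\<close>.\<close>
    using optimal_cycle_decomposition[OF game_half_game half_game_decomposition(1)]
    by (simp_all add: half_game_decomposition(2) card_descents_half_game)
  have "2 * int (card (descents \<Gamma>)) = int (n * (n + 1))"
    unfolding \<Gamma> card_descents_half_game card_index_pairs[symmetric] by simp
  \<comment> \<open>The computation is \<open>(2 * n + 1) * n - n * (n + 1) = n * n\<close>.\<close>
  then have "beta \<Gamma> = int (n\<^sup>2)"
    using opt(1) card_half_game[of n] unfolding \<Gamma>
    by (simp add: power2_eq_square algebra_simps)
  then show ?thesis using opt(2) by simp
qed

end
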